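(* Let $Z \in M_n(\mathbb{R})$ be a positive definite symmetric matrix with $Z_{ii}=1$ for all $i$. Then one can choose a non-degenerate (invertible) matrix $V=(v_1\ \dots\ v_n)\in M_n(\mathbb{R})$, with columns $v_1,\dots,v_n\in\mathbb{R}^n$, satisfying $Z=V^tV$. For such $V$, let $R$ be the radius of the circumsphere of the points $\{v_1,\dots,v_n\}\subset\mathbb{R}^n$, i.e. the radius of the $(n-2)$-dimensional sphere appearing as the intersection of the unit sphere in $\mathbb{R}^n$ and the affine span $$\mathrm{Aff}\{v_1,\dots,v_n\}=\Big\{Va \;\Big|\; a\in\mathbb{R}^n,\ \sum_i a_i=1\Big\}.$$ Then $$\mathrm{Mag}\, Z=\frac{1}{1-R^2}.$$ Furthermore, if $Va$ (with $a\in\mathbb{R}^n$, $\sum_i a_i=1$) is the center of this circumsphere, then $$w=\frac{1}{1-R^2}\,a$$ is a magnitude weighting of $Z$.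
   Context: $C^t$ denotes the transpose of a matrix $C$, and $1_n=(1,\dots,1)^t\in\mathbb{R}^n$. A magnitude weighting of a symmetric matrix $Z\in M_n(\mathbb{R})$ is a vector $w\in\mathbb{R}^n$ with $Zw=1_n$. If one exists, the magnitude of $Z$ is $\mathrm{Mag}\,Z=\sum_i w_i$; for invertible $Z$ this equals $\sum_{i,j}(Z^{-1})_{ij}$. The unit sphere and the radius are taken with respect to the standard Euclidean inner product on $\mathbb{R}^n$. (The $v_i$ are unit vectors since $Z_{ii}=1$; the circumsphere lies in $\mathrm{Aff}\{v_1,\dots,v_n\}$ and its center belongs to $\mathrm{Aff}\{v_1,\dots,v_n\}$; for $n=1$ it is a single point and $R=0$.) *)

theory Defs
  imports "HOL-Analysis.Analysis"
begin

definition pos_def_symmetric :: "real ^ 'n ^ 'n \<Rightarrow> bool" where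
  "pos_def_symmetric Z \<longleftrightarrow> transpose Z = Z \<and> (\<forall>x. x \<noteq> 0 \<longrightarrow> x \<bullet> (Z *v x) > 0)"

text \<open>The constant \<^term>\<open>1 :: real ^ 'n\<close> is the all-ones vector.\<close>

definition magnitude_weighting :: "real ^ 'n ^ 'n \<Rightarrow> real ^ 'n \<Rightarrow> bool" where
  "magnitude_weighting Z w \<longleftrightarrow> Z *v w = 1"

text \<open>
  Meaningful only for a symmetric \<open>Z\<close> that has some weighting: by symmetry all weightings then
  have the same total, see \<open>Mag_eq\<close> below.
\<close>

definition Mag :: "real ^ 'n ^ 'n \<Rightarrow> real" where
  "Mag Z = (THE m. \<exists>w. magnitude_weighting Z w \<and> m = (\<Sum>i\<in>UNIV. w $ i))"

text \<open>
  The set \<open>sphere c R \<inter> affine hull S\<close> is a circumsphere of \<open>S\<close>: its center is required to lie in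
  the affine span of \<open>S\<close>.  Degenerate radius \<open>R = 0\<close> is allowed (\<open>S\<close> a single point).
\<close>

definition is_circumsphere :: "'a::euclidean_space set \<Rightarrow> 'a \<Rightarrow> real \<Rightarrow> bool" where
  "is_circumsphere S c R \<longleftrightarrow> c \<in> affine hull S \<and> 0 \<le> R \<and> S \<subseteq> sphere c R"

lemma inner_one_vec: "(1 :: real ^ 'n) \<bullet> w = (\<Sum>i\<in>UNIV. w $ i)"
  by (simp add: inner_vec_def)

lemma Mag_eq:
  assumes "transpose Z = Z" and w: "magnitude_weighting Z w"
  shows "Mag Z = (\<Sum>i\<in>UNIV. w $ i)"
  unfolding Mag_def
proof (rule the_equality)
  show "\<exists>u. magnitude_weighting Z u \<and> (\<Sum>i\<in>UNIV. w $ i) = (\<Sum>i\<in>UNIV. u $ i)"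
    using w by blast
next
  fix m
  assume "\<exists>u. magnitude_weighting Z u \<and> m = (\<Sum>i\<in>UNIV. u $ i)"
  then obtain u where u: "Z *v u = 1" and m: "m = 1 \<bullet> u"
    unfolding magnitude_weighting_def inner_one_vec by blast
  have "m = (Z *v w) \<bullet> u"
    using w m by (simp add: magnitude_weighting_def)
  also have "\<dots> = w \<bullet> (Z *v u)"
    by (metis assms(1) dot_lmul_matrix inner_commute transpose_matrix_vector)
  also have "\<dots> = (\<Sum>i\<in>UNIV. w $ i)"
    by (simp add: u inner_commute inner_one_vec)
  finally show "m = (\<Sum>i\<in>UNIV. w $ i)" .
qed

lemma affine_hull_columns:
  fixes V :: "real ^ 'n ^ 'm"
  shows "affine hull (columns V) = {V *v a | a. (\<Sum>i\<in>UNIV. a $ i) = 1}"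
proof -
  let ?e = "\<lambda>i::'n. axis i (1::real)"
  have inj: "inj ?e"
    by (simp add: inj_def axis_eq_axis)
  have cols: "columns V = (*v) V ` range ?e"
    unfolding columns_def image_image matrix_vector_mult_basis by auto
  have rep: "(\<Sum>i\<in>UNIV. u i *\<^sub>R ?e i) = (\<chi> i. u i)" for u
    by (simp add: vec_eq_iff axis_def if_distrib if_distribR cong: if_cong)
  have "affine hull (range ?e) = {a. (\<Sum>i\<in>UNIV. a $ i) = 1}" (is "_ = ?A")
  proof (intro set_eqI iffI)
    fix a assume "a \<in> affine hull (range ?e)"
    then obtain u where "sum u (range ?e) = 1" "(\<Sum>v\<in>range ?e. u v *\<^sub>R v) = a"
      by (auto simp: affine_hull_finite)
    then show "a \<in> ?A"
      using inj rep[of "u \<circ> ?e"] by (auto simp: sum.reindex)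
  next
    fix a assume a: "a \<in> ?A"
    let ?u = "\<lambda>v. a $ (inv ?e v)"
    have "sum ?u (range ?e) = 1" "(\<Sum>v\<in>range ?e. ?u v *\<^sub>R v) = a"
      using a inj rep[of "($) a"] by (simp_all add: sum.reindex inv_f_f[OF inj])
    then show "a \<in> affine hull (range ?e)"
      by (subst affine_hull_finite) (auto intro!: exI[of _ ?u])
  qed
  then show ?thesis
    unfolding cols affine_hull_linear_image[OF matrix_vector_mul_bounded_linear, symmetric]
    by auto
qed

end

theory Submission
  imports Defs
begin

text \<open>
  Let \<open>Z = V\<^sup>T V\<close> with \<open>V\<close> invertible, and let \<open>u\<close> be the solution of \<open>V\<^sup>T u = 1\<close>.  Everything is read
  off from this one vector.

  The columns of \<open>V\<close> have inner product \<open>1\<close> with \<open>u\<close>, so their affine span is the whole hyperplane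
  \<open>u \<bullet> x = 1\<close>.  By Pythagoras the unit sphere cuts this hyperplane in a sphere whose center is the
  foot \<open>u / |u|\<^sup>2\<close> of the perpendicular from the origin, and whose radius satisfies
  \<open>R\<^sup>2 = 1 - 1 / |u|\<^sup>2\<close>.  No other sphere centered in the hyperplane contains the columns
  (\<open>is_circumsphere_hyperplane_iff\<close>).  Hence \<open>1 / (1 - R\<^sup>2) = |u|\<^sup>2\<close>.

  On the other hand \<open>Z w = V\<^sup>T (V w)\<close>, so the weighting \<open>w\<close> is characterized by \<open>V w = u\<close>.  If
  \<open>V a = u / |u|\<^sup>2\<close> is the center, then \<open>w = |u|\<^sup>2 a\<close>, and its total is \<open>|u|\<^sup>2\<close> because the
  entries of \<open>a\<close> sum to \<open>1\<close>.

  The factorization of \<open>Z\<close> comes from a basis that is orthonormal for the form \<open>x \<bullet> Z y\<close>: if such a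
  basis forms the columns of \<open>W\<close>, then \<open>W\<^sup>T Z W\<close> is the identity and \<open>V = W\<^sup>T Z\<close> is the
  inverse of \<open>W\<close>.
\<close>

section \<open>Factorization of a positive definite matrix\<close>

text \<open>
  Gram--Schmidt without formulas: while fewer than \<open>n\<close> vectors have been chosen, their images under
  \<open>Z\<close> span a proper subspace, and a normalized vector perpendicular to it is the next member.
\<close>

lemma pos_def_orthonormal_family:
  fixes Z :: "real ^ 'n ^ 'n" and S :: "'n set"
  assumes "pos_def_symmetric Z"
  shows "\<exists>e. \<forall>i\<in>S. \<forall>j\<in>S. e i \<bullet> (Z *v e j) = (if i = j then 1 else 0)"
proof -
  have symm: "x \<bullet> (Z *v y) = y \<bullet> (Z *v x)" for x y
    using assms unfolding pos_def_symmetric_def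
    by (metis dot_lmul_matrix inner_commute transpose_matrix_vector)
  have "finite S" by simp
  then show ?thesis
  proof (induction S rule: finite_induct)
    case (insert k S)
    then obtain e where e: "\<forall>i\<in>S. \<forall>j\<in>S. e i \<bullet> (Z *v e j) = (if i = j then 1 else 0)"
      by blast
    let ?A = "(\<lambda>i. Z *v e i) ` S"
    have "dim ?A \<le> card S"
      by (meson card_image_le dim_le_card' finite_imageI insert.hyps(1) order_trans)
    also have "\<dots> < CARD('n)"
      using insert.hyps(2) by (intro psubset_card_mono) auto
    finally have "dim ?A < DIM(real ^ 'n)" by simp
    then obtain x where x: "x \<noteq> 0" "\<And>y. y \<in> span ?A \<Longrightarrow> orthogonal x y"
      using orthogonal_to_subspace_exists by blast
    have perp: "x \<bullet> (Z *v e i) = 0" if "i \<in> S" for i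
      using that x(2)[OF span_base] by (auto simp: orthogonal_def)
    define q where "q = x \<bullet> (Z *v x)"
    have q: "q > 0"
      using assms x(1) by (simp add: q_def pos_def_symmetric_def)
    let ?y = "(1 / sqrt q) *\<^sub>R x"
    have yy: "?y \<bullet> (Z *v ?y) = 1"
      using q by (simp add: matrix_vector_mult_scaleR flip: q_def)
    have ye: "?y \<bullet> (Z *v e i) = 0" "e i \<bullet> (Z *v ?y) = 0" if "i \<in> S" for i
      using perp[OF that] symm[of "e i" ?y] by simp_all
    show ?case
      using e yy ye insert.hyps(2) by (intro exI[of _ "e(k := ?y)"]) auto
  qed simp
qed

lemma pos_def_symmetric_factorization:
  fixes Z :: "real ^ 'n ^ 'n"
  assumes "pos_def_symmetric Z"
  shows "\<exists>V :: real ^ 'n ^ 'n. invertible V \<and> Z = transpose V ** V"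
proof -
  obtain e :: "'n \<Rightarrow> real ^ 'n" where e: "\<And>i j. e i \<bullet> (Z *v e j) = (if i = j then 1 else 0)"
    using pos_def_orthonormal_family[OF assms, of UNIV] by blast
  define W :: "real ^ 'n ^ 'n" where "W = (\<chi> i j. e j $ i)"
  define V where "V = transpose W ** Z"
  have "V ** W = mat 1"
  proof -
    have "(transpose W ** (Z ** W)) $ i $ j = e i \<bullet> (Z *v e j)" for i j
      by (simp add: W_def matrix_matrix_mult_def transpose_def inner_vec_def
          matrix_vector_mult_def)
    then show ?thesis
      using e by (simp add: V_def vec_eq_iff mat_def flip: matrix_mul_assoc)
  qed
  then have WV: "W ** V = mat 1" and "invertible V"
    using matrix_left_right_inverse invertible_def by blast+
  have "transpose V ** V = transpose Z ** (W ** V)"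
    by (simp add: V_def matrix_transpose_mul matrix_mul_assoc)
  also have "\<dots> = Z"
    using assms by (simp add: WV pos_def_symmetric_def)
  finally show ?thesis
    using \<open>invertible V\<close> by metis
qed

section \<open>Circumspheres in a hyperplane\<close>

text \<open>Pythagoras, for the foot of the perpendicular from the origin to a hyperplane.\<close>

lemma dist_hyperplane_foot:
  fixes u :: "'a::real_inner"
  assumes "u \<bullet> x = 1"
  shows "(dist (u /\<^sub>R (u \<bullet> u)) x)\<^sup>2 = (norm x)\<^sup>2 - 1 / (u \<bullet> u)"
proof -
  have "u \<noteq> 0" using assms by auto
  then show ?thesis
    using assms
    by (simp add: dist_norm power2_norm_eq_inner inner_diff_left inner_diff_right
        inner_commute[of x u] field_simps)
qed

lemma sphere_Int_hyperplane:
  fixes u :: "'a::real_inner"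
  assumes "0 \<le> R" "R\<^sup>2 = 1 - 1 / (u \<bullet> u)"
  shows "sphere 0 1 \<inter> {x. u \<bullet> x = 1} = sphere (u /\<^sub>R (u \<bullet> u)) R \<inter> {x. u \<bullet> x = 1}"
proof -
  have "norm x = 1 \<longleftrightarrow> dist (u /\<^sub>R (u \<bullet> u)) x = R" if "u \<bullet> x = 1" for x
  proof -
    have "norm x = 1 \<longleftrightarrow> (norm x)\<^sup>2 = 1\<^sup>2"
      using power2_eq_iff_nonneg[of "norm x" 1] by simp
    also have "\<dots> \<longleftrightarrow> (dist (u /\<^sub>R (u \<bullet> u)) x)\<^sup>2 = R\<^sup>2"
      by (simp add: dist_hyperplane_foot[OF that] assms(2))
    also have "\<dots> \<longleftrightarrow> dist (u /\<^sub>R (u \<bullet> u)) x = R"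
      using assms(1) by (intro power2_eq_iff_nonneg) auto
    finally show ?thesis .
  qed
  then show ?thesis by auto
qed

text \<open>
  The content is uniqueness.  For points of the unit sphere, being at a fixed distance from \<open>c\<close> means
  having a fixed inner product \<open>k\<close> with \<open>c\<close>, and this condition extends to the affine hull.
  Evaluating it at \<open>c\<close> and at the foot \<open>f\<close> of the perpendicular gives \<open>c \<bullet> c = c \<bullet> f = k\<close>.
  Since \<open>c \<bullet> f = f \<bullet> f\<close> for every \<open>c\<close> in the hyperplane, it follows that \<open>c = f\<close>.
\<close>

lemma is_circumsphere_hyperplane_iff:
  fixes u :: "'a::euclidean_space"
  assumes hull: "affine hull S = {x. u \<bullet> x = 1}" and unit: "S \<subseteq> sphere 0 1" and "S \<noteq> {}"
  shows "is_circumsphere S c R \<longleftrightarrow>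
    c = u /\<^sub>R (u \<bullet> u) \<and> 0 \<le> R \<and> R\<^sup>2 = 1 - 1 / (u \<bullet> u)"
proof
  let ?f = "u /\<^sub>R (u \<bullet> u)"
  obtain v where v: "v \<in> S" using \<open>S \<noteq> {}\<close> by blast
  have S: "u \<bullet> x = 1" "norm x = 1" if "x \<in> S" for x
    using that hull hull_inc[of x S affine] unit by auto
  have uu: "u \<bullet> u \<noteq> 0" using S(1)[OF v] by auto
  {
    assume c: "is_circumsphere S c R"
    define k where "k = (1 + c \<bullet> c - R\<^sup>2) / 2"
    have uc: "u \<bullet> c = 1" and R: "0 \<le> R"
      using c hull by (auto simp: is_circumsphere_def)
    have dist: "dist c x = R" if "x \<in> S" for x
      using c that by (auto simp: is_circumsphere_def)
    have "c \<bullet> x = k" if "x \<in> S" for x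
    proof -
      have "R\<^sup>2 = c \<bullet> c - 2 * (c \<bullet> x) + (norm x)\<^sup>2"
        unfolding dist[OF that, symmetric]
        by (simp add: dist_norm power2_norm_eq_inner inner_diff_left inner_diff_right
            inner_commute[of x c])
      then show ?thesis using S(2)[OF that] by (simp add: k_def)
    qed
    then have "affine hull S \<subseteq> {x. c \<bullet> x = k}"
      by (intro hull_minimal affine_hyperplane) auto
    then have k: "c \<bullet> x = k" if "u \<bullet> x = 1" for x
      using that hull by auto
    have "c \<bullet> c = k" by (rule k[OF uc])
    moreover have "c \<bullet> ?f = k" using uu by (intro k) simp
    moreover have "c \<bullet> ?f = ?f \<bullet> ?f" using uu uc by (simp add: inner_commute[of c u])
    ultimately have "(c - ?f) \<bullet> (c - ?f) = 0"
      by (simp add: inner_diff_left inner_diff_right inner_commute[of ?f c]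
          del: inner_scaleR_left inner_scaleR_right)
    then have cf: "c = ?f" by simp
    have "R\<^sup>2 = 1 - 1 / (u \<bullet> u)"
      using dist_hyperplane_foot[OF S(1)[OF v]] dist[OF v] S(2)[OF v] cf by simp
    then show "c = ?f \<and> 0 \<le> R \<and> R\<^sup>2 = 1 - 1 / (u \<bullet> u)"
      using cf R by simp
  }
  assume c: "c = ?f \<and> 0 \<le> R \<and> R\<^sup>2 = 1 - 1 / (u \<bullet> u)"
  then have "S \<subseteq> sphere c R"
    using sphere_Int_hyperplane[of R u] S by auto
  then show "is_circumsphere S c R"
    using c hull uu by (simp add: is_circumsphere_def)
qed

lemma ex1_circumsphere_hyperplane:
  fixes u :: "'a::euclidean_space"
  assumes hull: "affine hull S = {x. u \<bullet> x = 1}" and unit: "S \<subseteq> sphere 0 1" and "S \<noteq> {}"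
  shows "\<exists>!s. is_circumsphere S (fst s) (snd s)"
proof -
  obtain v where "v \<in> S" using \<open>S \<noteq> {}\<close> by blast
  then have v: "u \<bullet> v = 1" "norm v = 1"
    using hull hull_inc[of v S affine] unit by auto
  \<comment> \<open>The square of the prospective radius is a squared distance, hence nonnegative.\<close>
  have nonneg: "1 - 1 / (u \<bullet> u) \<ge> 0"
    using zero_le_power2[of "dist (u /\<^sub>R (u \<bullet> u)) v"] v
    by (simp add: dist_hyperplane_foot[OF v(1)] del: zero_le_power2)
  have "is_circumsphere S c R \<longleftrightarrow> c = u /\<^sub>R (u \<bullet> u) \<and> R = sqrt (1 - 1 / (u \<bullet> u))" for c R
    unfolding is_circumsphere_hyperplane_iff[OF assms]
    using nonneg by (metis real_sqrt_ge_zero real_sqrt_pow2 real_sqrt_unique)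
  then show ?thesis
    by (intro ex1I[of _ "(u /\<^sub>R (u \<bullet> u), sqrt (1 - 1 / (u \<bullet> u)))"]) (auto simp: prod_eq_iff)
qed

section \<open>The columns of the factor and the magnitude\<close>

lemma affine_hull_columns_invertible:
  fixes V :: "real ^ 'n ^ 'n"
  assumes "invertible V" and u: "transpose V *v u = 1"
  shows "affine hull (columns V) = {x. u \<bullet> x = 1}"
proof -
  have "u \<bullet> (V *v a) = (\<Sum>i\<in>UNIV. a $ i)" for a
    by (metis u dot_lmul_matrix inner_one_vec transpose_matrix_vector)
  moreover obtain V' where "V ** V' = mat 1"
    using assms(1) by (auto simp: invertible_def)
  then have "V *v (V' *v x) = x" for x
    by (simp add: matrix_vector_mul_assoc)
  ultimately show ?thesis
    unfolding affine_hull_columns by (auto, metis)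
qed

lemma inj_column_invertible:
  fixes V :: "real ^ 'n ^ 'n"
  assumes "invertible V"
  shows "inj (\<lambda>i. column i V)"
proof (rule injI)
  fix i j assume "column i V = column j V"
  then have "V *v axis i 1 = V *v axis j 1"
    by (simp add: matrix_vector_mult_basis)
  then have "axis i (1::real) = axis j 1"
    using inj_matrix_vector_mult[OF assms] by (auto dest: injD)
  then show "i = j" by (simp add: axis_eq_axis)
qed

theorem theorem1p1:
  fixes Z :: "real ^ 'n ^ 'n"
  assumes "pos_def_symmetric Z"
    and "\<And>i. Z $ i $ i = 1"
  shows "(\<exists>V :: real ^ 'n ^ 'n. invertible V \<and> Z = transpose V ** V) \<and>
    (\<forall>V :: real ^ 'n ^ 'n. invertible V \<and> Z = transpose V ** V \<longrightarrow>
      aff_dim (columns V) = int CARD('n) - 1 \<and>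
      (\<exists>!s. is_circumsphere (columns V) (fst s) (snd s)) \<and>
      (\<forall>c R. is_circumsphere (columns V) c R \<longrightarrow>
        sphere 0 1 \<inter> affine hull (columns V) = sphere c R \<inter> affine hull (columns V) \<and>
        (CARD('n) \<ge> 2 \<longrightarrow> R > 0) \<and>
        1 - R\<^sup>2 \<noteq> 0 \<and>
        (\<exists>w. magnitude_weighting Z w) \<and>
        Mag Z = 1 / (1 - R\<^sup>2) \<and>
        (\<forall>a. (\<Sum>i\<in>UNIV. a $ i) = 1 \<and> V *v a = c \<longrightarrow>
          magnitude_weighting Z ((1 / (1 - R\<^sup>2)) *\<^sub>R a))))"
proof (intro conjI[OF pos_def_symmetric_factorization[OF assms(1)]] allI impI)
  fix V :: "real ^ 'n ^ 'n"
  assume "invertible V \<and> Z = transpose V ** V"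
  then have V: "invertible V" and Z: "Z = transpose V ** V" by auto
  obtain T where "transpose V ** T = mat 1"
    using transpose_invertible[OF V] by (auto simp: invertible_def)
  then have "transpose V *v (T *v 1) = 1"
    by (simp add: matrix_vector_mul_assoc)
  then obtain u where u: "transpose V *v u = 1" by blast
  note hull = affine_hull_columns_invertible[OF V u]
  have unit: "columns V \<subseteq> sphere 0 1"
  proof -
    have "norm (column i V) = 1" for i
      using assms(2)[of i] by (simp add: Z matrix_mult_transpose_dot_column norm_eq_1)
    then show ?thesis by (auto simp: columns_def)
  qed
  have ne: "columns V \<noteq> {}" by (auto simp: columns_def)
  have u0: "u \<noteq> 0" using u by (metis matrix_vector_mult_0_right zero_neq_one)
  have "aff_dim (columns V) = int CARD('n) - 1"
    using aff_dim_affine_hull[of "columns V"] aff_dim_hyperplane[OF u0, of 1] by (simp add: hull)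
  moreover note ex1_circumsphere_hyperplane[OF hull unit ne]
  moreover
  {
    fix c R assume circ: "is_circumsphere (columns V) c R"
    then have c: "c = u /\<^sub>R (u \<bullet> u)" and R: "0 \<le> R" "R\<^sup>2 = 1 - 1 / (u \<bullet> u)"
      using is_circumsphere_hyperplane_iff[OF hull unit ne] by auto
    have mag: "1 / (1 - R\<^sup>2) = u \<bullet> u" by (simp add: R)
    have pos: "R > 0" if two: "CARD('n) \<ge> 2"
    proof (rule ccontr)
      have "\<not> CARD('n) \<le> Suc 0" using two by simp
      then obtain i j :: 'n where "i \<noteq> j"
        unfolding card_le_Suc0_iff_eq[OF finite] by blast
      assume "\<not> R > 0"
      then have "column k V = c" for k
        using circ R(1) by (auto simp: is_circumsphere_def columns_def)
      with \<open>i \<noteq> j\<close> show False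
        using injD[OF inj_column_invertible[OF V], of i j] by simp
    qed
    have wt: "magnitude_weighting Z ((1 / (1 - R\<^sup>2)) *\<^sub>R a)" if "V *v a = c" for a
      using that u u0 unfolding mag
      by (simp add: magnitude_weighting_def Z matrix_vector_mult_scaleR c
          flip: matrix_vector_mul_assoc)
    obtain a where a: "(\<Sum>i\<in>UNIV. a $ i) = 1" "V *v a = c"
      using circ by (auto simp: is_circumsphere_def affine_hull_columns)
    have "Mag Z = 1 / (1 - R\<^sup>2)"
      using Mag_eq[OF _ wt[OF a(2)]] assms(1) a(1)
      by (simp add: pos_def_symmetric_def flip: sum_divide_distrib)
    moreover have "1 - R\<^sup>2 \<noteq> 0" using R(2) u0 by simp
    moreover note sphere_Int_hyperplane[OF R] pos wt a(2)
    ultimately have "sphere 0 1 \<inter> affine hull (columns V) = sphere c R \<inter> affine hull (columns V) \<and>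
        (CARD('n) \<ge> 2 \<longrightarrow> R > 0) \<and>
        1 - R\<^sup>2 \<noteq> 0 \<and>
        (\<exists>w. magnitude_weighting Z w) \<and>
        Mag Z = 1 / (1 - R\<^sup>2) \<and>
        (\<forall>a. (\<Sum>i\<in>UNIV. a $ i) = 1 \<and> V *v a = c \<longrightarrow>
          magnitude_weighting Z ((1 / (1 - R\<^sup>2)) *\<^sub>R a))"
      unfolding hull c[symmetric] by blast
  }
  ultimately show "aff_dim (columns V) = int CARD('n) - 1 \<and>
      (\<exists>!s. is_circumsphere (columns V) (fst s) (snd s)) \<and>
      (\<forall>c R. is_circumsphere (columns V) c R \<longrightarrow>
        sphere 0 1 \<inter> affine hull (columns V) = sphere c R \<inter> affine hull (columns V) \<and>
        (CARD('n) \<ge> 2 \<longrightarrow> R > 0) \<and>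
        1 - R\<^sup>2 \<noteq> 0 \<and>
        (\<exists>w. magnitude_weighting Z w) \<and>
        Mag Z = 1 / (1 - R\<^sup>2) \<and>
        (\<forall>a. (\<Sum>i\<in>UNIV. a $ i) = 1 \<and> V *v a = c \<longrightarrow>
          magnitude_weighting Z ((1 / (1 - R\<^sup>2)) *\<^sub>R a)))"
    by blast
qed

end
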